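(* Let $b$ and $c$ be positive integers. (1) For any $b$, the parameters $(q,c)$ with $q=bc$ are feasible whenever $c$ is congruent to $2$, $4$ or $6$ modulo $2b+1$. (2) If $b\equiv 1$ or $7 \pmod 9$, the parameters $(q,c)$ with $q=bc$ are feasible whenever $c$ is congruent to $2$, $4$ or $6$ modulo $(2b+1)/3$.
   Context: A pair $(q,c)$ of positive integers is called feasible (as parameters for a strongly regular graph with no triangles) if $1\le c\le q(q+1)$ and the following two conditions hold: (i) $c$ divides $q^4-q^2$; (ii) $c+2q$ divides the integer $q^4+3q^3+5q^2+3q+q\,(q^4-q^2)/c$. *)

theory Defs
  imports "HOL-Number_Theory.Cong"
begin

text \<open>
  Feasible parameters \<open>(q, c)\<close> for a strongly regular graph with no triangles.
  The integer division in the last conjunct is exact because of the preceding conjunct.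
\<close>

definition feasible :: "int \<Rightarrow> int \<Rightarrow> bool" where
  "feasible q c \<longleftrightarrow>
     0 < q \<and> 1 \<le> c \<and> c \<le> q * (q + 1) \<and>
     c dvd q ^ 4 - q ^ 2 \<and>
     c + 2 * q dvd q ^ 4 + 3 * q ^ 3 + 5 * q ^ 2 + 3 * q + q * ((q ^ 4 - q ^ 2) div c)"

end

theory Submission imports Defs
begin

text \<open>
  For \<open>q = b c\<close> both sides of the second divisibility condition carry a factor \<open>c\<close>; cancelling it
  leaves \<open>2 b + 1\<close> as the divisor of a polynomial in \<open>b\<close> and \<open>c\<close>. Modulo the odd number \<open>2 b + 1\<close>
  one may substitute \<open>b = -1/2\<close>, and clearing denominators by the unit \<open>32\<close> turns this polynomial
  into \<open>c\<^sup>3 - 12 c\<^sup>2 + 44 c - 48 = (c - 2) (c - 4) (c - 6)\<close>. Feasibility is therefore equivalent to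
  \<open>2 b + 1\<close> dividing this product (\<open>feasible_multiple_iff\<close>), which explains the residues
  \<open>2\<close>, \<open>4\<close> and \<open>6\<close>.

  The three factors lie in distinct residue classes modulo \<open>3\<close>, so their product is always a
  multiple of \<open>3\<close>. When \<open>b\<close> is \<open>1\<close> or \<open>7\<close> modulo \<open>9\<close>, the number \<open>2 b + 1\<close> is divisible by \<open>3\<close> exactly once,
  so a factor divisible by \<open>(2 b + 1) / 3\<close> already suffices.
\<close>

text \<open>
  The polynomial below is the one from the second divisibility condition after cancelling \<open>c\<close>.
  Its degree in \<open>b\<close> is \<open>5\<close>, so \<open>2\<^sup>5\<close> is the factor that makes the value at \<open>b = -1/2\<close> integral.
\<close>

lemma reduced_condition_iff:
  fixes b c :: int
  shows "2 * b + 1 dvd b ^ 4 * c ^ 3 + 3 * b ^ 3 * c ^ 2 + 5 * b ^ 2 * c + 3 * b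
             + b * (b ^ 4 * c ^ 3 - b ^ 2 * c)
         \<longleftrightarrow> 2 * b + 1 dvd (c - 2) * (c - 4) * (c - 6)"
    (is "?n dvd ?X \<longleftrightarrow> ?n dvd ?P")
proof -
  \<comment> \<open>The quotient of \<open>32 X - P\<close> by \<open>t + 1\<close>, where \<open>t = 2 b\<close>, collected by powers of \<open>c\<close>.\<close>
  define K where "K = (\<lambda>t. (t ^ 4 + t ^ 3 - t ^ 2 + t - 1) * c ^ 3 + 12 * (t ^ 2 - t + 1) * c ^ 2
                         + (- 4 * t ^ 2 + 44 * t - 44) * c + 48)"
  have identity: "32 * ?X = ?P + ?n * K (2 * b)"
    unfolding K_def by algebra
  have "coprime ?n 2"
    by simp
  then have "coprime ?n (2 ^ 5)"
    by (simp only: coprime_power_right_iff) simp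
  then have "coprime ?n 32"
    by simp
  then have "?n dvd ?X \<longleftrightarrow> ?n dvd 32 * ?X"
    by (simp only: coprime_dvd_mult_right_iff)
  also have "\<dots> \<longleftrightarrow> ?n dvd ?P"
    unfolding identity by (rule dvd_add_left_iff) (rule dvd_triv_left)
  finally show ?thesis .
qed

lemma feasible_multiple_iff:
  fixes b c :: int
  assumes b: "0 < b" and c: "0 < c"
  shows "feasible (b * c) c \<longleftrightarrow> 2 * b + 1 dvd (c - 2) * (c - 4) * (c - 6)"
proof -
  define X where "X = b ^ 4 * c ^ 3 + 3 * b ^ 3 * c ^ 2 + 5 * b ^ 2 * c + 3 * b
                        + b * (b ^ 4 * c ^ 3 - b ^ 2 * c)"
  have "0 < b * c"
    using b c by simp
  have "c * 1 \<le> c * (b * (b * c + 1))"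
    using b c \<open>0 < b * c\<close> by (intro mult_left_mono) (auto simp: int_one_le_iff_zero_less zero_less_mult_iff)
  then have bound: "c \<le> b * c * (b * c + 1)"
    by (simp add: mult_ac)
  have quartic: "(b * c) ^ 4 - (b * c) ^ 2 = c * (b ^ 4 * c ^ 3 - b ^ 2 * c)"
    by algebra
  then have quotient: "((b * c) ^ 4 - (b * c) ^ 2) div c = b ^ 4 * c ^ 3 - b ^ 2 * c"
    using c by simp
  have divisor: "c + 2 * (b * c) = c * (2 * b + 1)"
    by algebra
  have dividend: "(b * c) ^ 4 + 3 * (b * c) ^ 3 + 5 * (b * c) ^ 2 + 3 * (b * c)
                    + b * c * (b ^ 4 * c ^ 3 - b ^ 2 * c) = c * X"
    unfolding X_def by algebra
  have "feasible (b * c) c \<longleftrightarrow> c * (2 * b + 1) dvd c * X"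
    unfolding feasible_def quotient divisor dividend
    using \<open>0 < b * c\<close> c bound quartic by auto
  also have "\<dots> \<longleftrightarrow> 2 * b + 1 dvd X"
    using c by simp
  also have "\<dots> \<longleftrightarrow> 2 * b + 1 dvd (c - 2) * (c - 4) * (c - 6)"
    unfolding X_def by (rule reduced_condition_iff)
  finally show ?thesis .
qed

lemma dvd_product_if_cong_2_4_6:
  fixes c m :: int
  assumes "[c = 2] (mod m) \<or> [c = 4] (mod m) \<or> [c = 6] (mod m)"
  shows "m dvd (c - 2) * (c - 4) * (c - 6)"
  using assms by (auto simp: cong_iff_dvd_diff)

lemma three_dvd_product:
  fixes c :: int
  shows "3 dvd (c - 2) * (c - 4) * (c - 6)"
proof -
  have "3 dvd c - 2 \<or> 3 dvd c - 4 \<or> 3 dvd c - 6"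
    by presburger
  then show ?thesis
    by auto
qed

theorem theorem4:
  fixes b c :: int
  assumes "0 < b" and "0 < c"
  shows "([c = 2] (mod (2 * b + 1)) \<or> [c = 4] (mod (2 * b + 1)) \<or> [c = 6] (mod (2 * b + 1))
            \<longrightarrow> feasible (b * c) c)
       \<and> ([b = 1] (mod 9) \<or> [b = 7] (mod 9) \<longrightarrow>
            [c = 2] (mod ((2 * b + 1) div 3)) \<or> [c = 4] (mod ((2 * b + 1) div 3))
              \<or> [c = 6] (mod ((2 * b + 1) div 3))
            \<longrightarrow> feasible (b * c) c)"
proof (intro conjI impI)
  assume "[c = 2] (mod (2 * b + 1)) \<or> [c = 4] (mod (2 * b + 1)) \<or> [c = 6] (mod (2 * b + 1))"
  then show "feasible (b * c) c"
    using assms by (simp only: feasible_multiple_iff dvd_product_if_cong_2_4_6)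
next
  define m where "m = (2 * b + 1) div 3"
  assume "[b = 1] (mod 9) \<or> [b = 7] (mod 9)"
  then have "b mod 9 = 1 \<or> b mod 9 = 7"
    by (simp add: cong_def)
  then have n_eq: "2 * b + 1 = 3 * m" and "\<not> 3 dvd m"
    unfolding m_def by presburger+
  have "prime (3 :: int)"
    by simp
  then have "coprime 3 m"
    using \<open>\<not> 3 dvd m\<close> by (rule prime_imp_coprime)
  assume "[c = 2] (mod ((2 * b + 1) div 3)) \<or> [c = 4] (mod ((2 * b + 1) div 3))
            \<or> [c = 6] (mod ((2 * b + 1) div 3))"
  then have "m dvd (c - 2) * (c - 4) * (c - 6)"
    unfolding m_def by (rule dvd_product_if_cong_2_4_6)
  with three_dvd_product \<open>coprime 3 m\<close> have "3 * m dvd (c - 2) * (c - 4) * (c - 6)"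
    by (intro divides_mult)
  then show "feasible (b * c) c"
    using assms by (simp only: feasible_multiple_iff n_eq)
qed

end
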